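(* Let $(\Omega,\mathcal{F},\mu)$ be a measure space, $X$ a Banach space, $p\in[1,\infty)$, $k\geq 1$ an integer and $f\in L^p(X)$. Then every minimizer $h\in\mathscr{G}_{p,k}(X)$ for $f$ has a reduced form in special $f$-Voronoi form, and satisfies $\deg(h)=k$ whenever $f\notin\mathscr{G}_{p,k}(X)$.
   Context: A simple function is a function $\sum_{i=1}^n x_i\mathbf{1}_{A_i}$ with $n\ge 1$, $x_i\in X$, $A_i\in\mathcal{F}$. A function $f:\Omega\to X$ is strongly measurable if it is a pointwise limit of a sequence of simple functions. For $1\le p<\infty$, $L^p(X)=L^p(\Omega,\mathcal{F},\mu,X)$ is the Bochner space of strongly measurable $f:\Omega\to X$ with $\int_\Omega\|f\|^p\,d\mu<\infty$ (functions equal a.e. are identified), with norm $\|f\|_p=\left(\int_\Omega\|f\|^p\,d\mu\right)^{1/p}$. $\mathscr{G}_{p,k}(X)$ is the set of all functions $\sum_{i=1}^{l}x_i\mathbf{1}_{A_i}\in L^p(X)$ with $l\le k$, $\{A_i\}_{1\le i\le l}\subset\mathcal{F}$ a partition of $\Omega$, and $x_1,\dots,x_l\in X$. A minimizer for $f$ in $\mathscr{G}_{p,k}(X)$ is an $h\in\mathscr{G}_{p,k}(X)$ with $\|f-h\|_p=\inf_{g\in\mathscr{G}_{p,k}(X)}\|f-g\|_p$. A simple function written $h=\sum_{i=1}^m x_i\mathbf{1}_{A_i}$ is in reduced form if the $x_i$ are all different and $\{A_i\}_{1\le i\le m}$ is a measurable partition of $\Omega$ into sets of positive measure, up to null sets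 (that is, $\mu(A_i\cap A_j)=0$ for $i\ne j$ and $\mu(\Omega\setminus\bigcup_iA_i)=0$). The degree $\deg(h)$ is the least $l\ge1$ such that $h=\sum_{i=1}^l y_i\mathbf{1}_{B_i}$ a.e. for some simple function $\sum_{i=1}^l y_i\mathbf{1}_{B_i}$ with $\{B_i\}$ a measurable partition of $\Omega$ up to null sets. For a finite set $\mathbf{x}=\{x_1,\dots,x_m\}\subset X$ of different points, its Voronoi cells are $V_i=\{y\in X:\|y-x_i\|\le\min_{j\ne i}\|y-x_j\|\}$, $1\le i\le m$ (with $V_1=X$ if $m=1$). If $h=\sum_{i=1}^m x_i\mathbf{1}_{A_i}$ is in reduced form, it is in $f$-Voronoi form if $A_i\subset f^{-1}(V_i)$ up to a $\mu$-null set for all $i$. For $A\in\mathcal{F}$ and $x\in X$ put $M_p(f,A)(x)=\int_A\|f(w)-x\|^p\,\mu(dw)\in[0,\infty]$. A point $x\in X$ is a $p$-th mean of $f$ in $A$ if $M_p(f,A)(x)=\inf_{y\in X}M_p(f,A)(y)$. A function $h=\sum_{i=1}^m x_i\mathbf{1}_{A_i}$ in $f$-Voronoi form is in special $f$-Voronoi form if, for every $i$, $x_i$ is a $p$-th mean of $f$ in $A_i$. *)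

theory Defs
  imports "HOL-Analysis.Analysis"
begin

text \<open>
  Bochner spaces over a possibly non-separable Banach space. The library's Bochner integral is
  restricted to second countable spaces, so strong measurability is defined here; only integrals
  of real-valued functions are needed.

  Elements of \<open>L\<^sup>p\<close> are represented by functions on the carrier of the measure space rather than
  by equivalence classes. Accordingly, every equality between elements of \<open>L\<^sup>p\<close> is an almost
  everywhere equality, and \<open>G_space\<close> below is closed under almost everywhere equality inside
  \<open>Lp_space\<close>. Families indexed by \<open>1, \<dots>, l\<close> are indexed by \<open>{..<l}\<close>.
\<close>

definition strongly_measurable :: "'a measure \<Rightarrow> ('a \<Rightarrow> 'b::real_normed_vector) \<Rightarrow> bool" where
  "strongly_measurable M f \<longleftrightarrow>
     (\<exists>s. (\<forall>n. simple_function M (s n)) \<and> (\<forall>w\<in>space M. (\<lambda>n. s n w) \<longlonglongrightarrow> f w))"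

definition Lp_space :: "'a measure \<Rightarrow> real \<Rightarrow> ('a \<Rightarrow> 'b::real_normed_vector) set" where
  "Lp_space M p =
     {f. strongly_measurable M f \<and> (\<integral>\<^sup>+w. ennreal (norm (f w) powr p) \<partial>M) < \<infinity>}"

definition Lp_norm :: "'a measure \<Rightarrow> real \<Rightarrow> ('a \<Rightarrow> 'b::real_normed_vector) \<Rightarrow> real" where
  "Lp_norm M p f = (\<integral>w. norm (f w) powr p \<partial>M) powr (1 / p)"

definition step_fun :: "nat \<Rightarrow> (nat \<Rightarrow> 'b::real_normed_vector) \<Rightarrow> (nat \<Rightarrow> 'a set) \<Rightarrow> 'a \<Rightarrow> 'b" where
  "step_fun l x A w = (\<Sum>i<l. indicator (A i) w *\<^sub>R x i)"

text \<open>
  Partition blocks may be empty, which does not affect the functions obtained from partitions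
  into at most \<open>k\<close> blocks.
\<close>

definition measurable_partition :: "'a measure \<Rightarrow> nat \<Rightarrow> (nat \<Rightarrow> 'a set) \<Rightarrow> bool" where
  "measurable_partition M l A \<longleftrightarrow>
     (\<forall>i<l. A i \<in> sets M) \<and> disjoint_family_on A {..<l} \<and> (\<Union>i<l. A i) = space M"

definition ae_partition :: "'a measure \<Rightarrow> nat \<Rightarrow> (nat \<Rightarrow> 'a set) \<Rightarrow> bool" where
  "ae_partition M l A \<longleftrightarrow>
     (\<forall>i<l. A i \<in> sets M) \<and>
     (\<forall>i<l. \<forall>j<l. i \<noteq> j \<longrightarrow> emeasure M (A i \<inter> A j) = 0) \<and>
     emeasure M (space M - (\<Union>i<l. A i)) = 0"

definition G_space :: "'a measure \<Rightarrow> real \<Rightarrow> nat \<Rightarrow> ('a \<Rightarrow> 'b::real_normed_vector) set" where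
  "G_space M p k =
     {g \<in> Lp_space M p. \<exists>l x A. 1 \<le> l \<and> l \<le> k \<and> measurable_partition M l A \<and>
        (AE w in M. g w = step_fun l x A w)}"

definition is_minimizer ::
    "'a measure \<Rightarrow> real \<Rightarrow> nat \<Rightarrow> ('a \<Rightarrow> 'b::real_normed_vector) \<Rightarrow> ('a \<Rightarrow> 'b) \<Rightarrow> bool" where
  "is_minimizer M p k f h \<longleftrightarrow>
     h \<in> G_space M p k \<and>
     Lp_norm M p (\<lambda>w. f w - h w) = (INF g\<in>G_space M p k. Lp_norm M p (\<lambda>w. f w - g w))"

text \<open>
  Positivity of \<open>m\<close> is not required in a reduced form: it follows from the other conditions unless
  the whole space is a null set, in which case \<open>m = 0\<close> is the only possibility.
\<close>

definition reduced_form ::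
    "'a measure \<Rightarrow> ('a \<Rightarrow> 'b::real_normed_vector) \<Rightarrow> nat \<Rightarrow> (nat \<Rightarrow> 'b) \<Rightarrow> (nat \<Rightarrow> 'a set) \<Rightarrow> bool" where
  "reduced_form M h m x A \<longleftrightarrow>
     (AE w in M. h w = step_fun m x A w) \<and> inj_on x {..<m} \<and>
     ae_partition M m A \<and> (\<forall>i<m. emeasure M (A i) > 0)"

definition simple_degree :: "'a measure \<Rightarrow> ('a \<Rightarrow> 'b::real_normed_vector) \<Rightarrow> nat" where
  "simple_degree M h =
     (LEAST l. 1 \<le> l \<and> (\<exists>y B. ae_partition M l B \<and> (AE w in M. h w = step_fun l y B w)))"

text \<open>
  Quantifying over \<open>j\<close> instead of taking a minimum makes the cell the whole space if \<open>m = 1\<close>.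
\<close>

definition voronoi_cell :: "nat \<Rightarrow> (nat \<Rightarrow> 'b::real_normed_vector) \<Rightarrow> nat \<Rightarrow> 'b set" where
  "voronoi_cell m x i = {y. \<forall>j<m. j \<noteq> i \<longrightarrow> norm (y - x i) \<le> norm (y - x j)}"

definition voronoi_form ::
    "'a measure \<Rightarrow> ('a \<Rightarrow> 'b::real_normed_vector) \<Rightarrow> ('a \<Rightarrow> 'b) \<Rightarrow>
     nat \<Rightarrow> (nat \<Rightarrow> 'b) \<Rightarrow> (nat \<Rightarrow> 'a set) \<Rightarrow> bool" where
  "voronoi_form M f h m x A \<longleftrightarrow>
     reduced_form M h m x A \<and>
     (\<forall>i<m. AE w in M. w \<in> A i \<longrightarrow> w \<in> f -` voronoi_cell m x i)"

definition pth_moment ::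
    "'a measure \<Rightarrow> real \<Rightarrow> ('a \<Rightarrow> 'b::real_normed_vector) \<Rightarrow> 'a set \<Rightarrow> 'b \<Rightarrow> ennreal" where
  "pth_moment M p f A x = (\<integral>\<^sup>+w\<in>A. ennreal (norm (f w - x) powr p) \<partial>M)"

definition is_pth_mean ::
    "'a measure \<Rightarrow> real \<Rightarrow> ('a \<Rightarrow> 'b::real_normed_vector) \<Rightarrow> 'a set \<Rightarrow> 'b \<Rightarrow> bool" where
  "is_pth_mean M p f A x \<longleftrightarrow> pth_moment M p f A x = (INF y. pth_moment M p f A y)"

definition special_voronoi_form ::
    "'a measure \<Rightarrow> real \<Rightarrow> ('a \<Rightarrow> 'b::real_normed_vector) \<Rightarrow> ('a \<Rightarrow> 'b) \<Rightarrow>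
     nat \<Rightarrow> (nat \<Rightarrow> 'b) \<Rightarrow> (nat \<Rightarrow> 'a set) \<Rightarrow> bool" where
  "special_voronoi_form M p f h m x A \<longleftrightarrow>
     voronoi_form M f h m x A \<and> (\<forall>i<m. is_pth_mean M p f (A i) (x i))"

end

theory Submission
  imports Defs
begin

text \<open>
  Membership in \<open>\<G>\<^sub>p\<^sub>,\<^sub>k\<close> only depends on the number of essential values: an \<open>L\<^sup>p\<close> function lies in
  it iff it takes almost everywhere at most \<open>k\<close> values (\<open>G_space_iff_card_values\<close>). So a minimizer
  \<open>h\<close> may be overwritten by a constant \<open>y\<close> on any measurable set \<open>B\<close> as long as there are still at
  most \<open>k\<close> values, and minimality says that this does not decrease the \<open>p\<close>-th power cost on \<open>B\<close>
  (\<open>minimizer_overwrite\<close>). Everything follows from a choice of \<open>B\<close> and \<open>y\<close>.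

  With \<open>B\<close> a level set of \<open>h\<close> and \<open>y\<close> arbitrary, the old value disappears when the new one is
  introduced, so each value is a \<open>p\<close>-th mean of \<open>f\<close> on its level set.

  With \<open>B\<close> the set where \<open>y\<close> is strictly closer to \<open>f\<close> than \<open>h\<close> is, the cost would strictly decrease
  unless \<open>B\<close> is a null set. Thus \<open>h\<close> is almost everywhere at least as close to \<open>f\<close> as any \<open>y\<close>
  whose addition to the values of \<open>h\<close> is affordable (\<open>minimizer_nearest\<close>). The values of \<open>h\<close>
  themselves are always affordable, which is the Voronoi condition. If \<open>h\<close> has fewer than \<open>k\<close> values,
  every point \<open>y\<close> is affordable; letting \<open>y\<close> run through a countable set that is dense in the range of
  \<open>f\<close> gives \<open>f = h\<close> almost everywhere, so that \<open>f\<close> itself lies in \<open>\<G>\<^sub>p\<^sub>,\<^sub>k\<close>.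
\<close>

section \<open>Strongly measurable functions\<close>

lemma strongly_measurable_norm_diff [measurable]:
  assumes "strongly_measurable M f" "strongly_measurable M g"
  shows "(\<lambda>w. norm (f w - g w)) \<in> borel_measurable M"
proof -
  obtain s where s: "\<And>n. simple_function M (s n)" "\<And>w. w \<in> space M \<Longrightarrow> (\<lambda>n. s n w) \<longlonglongrightarrow> f w"
    using assms(1) unfolding strongly_measurable_def by blast
  obtain t where t: "\<And>n. simple_function M (t n)" "\<And>w. w \<in> space M \<Longrightarrow> (\<lambda>n. t n w) \<longlonglongrightarrow> g w"
    using assms(2) unfolding strongly_measurable_def by blast
  show ?thesis
  proof (rule borel_measurable_LIMSEQ_real)
    show "(\<lambda>w. norm (s n w - t n w)) \<in> borel_measurable M" for n
      by (intro borel_measurable_simple_function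
          simple_function_compose2[of M "s n" "t n" "\<lambda>a b. norm (a - b)"] s t)
    show "(\<lambda>n. norm (s n w - t n w)) \<longlonglongrightarrow> norm (f w - g w)" if "w \<in> space M" for w
      using s(2)[OF that] t(2)[OF that] by (intro tendsto_intros)
  qed
qed

lemma strongly_measurable_const [simp]: "strongly_measurable M (\<lambda>_. c)"
  unfolding strongly_measurable_def by (intro exI[of _ "\<lambda>_ _. c"]) simp

lemma strongly_measurable_If_set:
  assumes "strongly_measurable M h" "B \<in> sets M"
  shows "strongly_measurable M (\<lambda>w. if w \<in> B then y else h w)"
proof -
  obtain s where s: "\<And>n. simple_function M (s n)" "\<And>w. w \<in> space M \<Longrightarrow> (\<lambda>n. s n w) \<longlonglongrightarrow> h w"
    using assms(1) unfolding strongly_measurable_def by blast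
  have "simple_function M (\<lambda>w. if w \<in> B then y else s n w)" for n
    by (rule simple_function_If_set) (use assms(2) s in \<open>auto simp: sets.Int_space_eq2\<close>)
  moreover have "(\<lambda>n. if w \<in> B then y else s n w) \<longlonglongrightarrow> (if w \<in> B then y else h w)"
    if "w \<in> space M" for w
    using s(2)[OF that] by auto
  ultimately show ?thesis
    unfolding strongly_measurable_def by (intro exI[of _ "\<lambda>n w. if w \<in> B then y else s n w"]) auto
qed

lemma strongly_measurable_norm [measurable]:
  assumes "strongly_measurable M f"
  shows "(\<lambda>w. norm (f w)) \<in> borel_measurable M"
  using strongly_measurable_norm_diff[OF assms strongly_measurable_const[of M 0]] by simp

lemma strongly_measurable_level_set:
  assumes "strongly_measurable M h"
  shows "{w \<in> space M. h w = c} \<in> sets M"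
proof -
  have [measurable]: "(\<lambda>w. norm (h w - c)) \<in> borel_measurable M"
    using assms by (intro strongly_measurable_norm_diff strongly_measurable_const)
  have "{w \<in> space M. norm (h w - c) = 0} \<in> sets M"
    by measurable
  then show ?thesis by simp
qed

lemma strongly_measurable_separable_range:
  assumes "strongly_measurable M f"
  obtains D where "countable D" "\<And>w e. w \<in> space M \<Longrightarrow> e > 0 \<Longrightarrow> \<exists>d\<in>D. norm (f w - d) < e"
proof -
  obtain s where s: "\<And>n. simple_function M (s n)" "\<And>w. w \<in> space M \<Longrightarrow> (\<lambda>n. s n w) \<longlonglongrightarrow> f w"
    using assms unfolding strongly_measurable_def by blast
  show ?thesis
  proof (rule that)
    show "countable (\<Union>n. s n ` space M)"
      using s(1) by (intro countable_UN) (auto simp: simple_function_def intro: countable_finite)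
    show "\<exists>d\<in>(\<Union>n. s n ` space M). norm (f w - d) < e" if w: "w \<in> space M" and e: "e > 0" for w e
    proof -
      obtain n where "norm (s n w - f w) < e"
        using LIMSEQ_D[OF s(2)[OF w] e] by blast
      then show ?thesis
        using w by (auto simp: norm_minus_commute)
    qed
  qed
qed

section \<open>Differences of \<open>p\<close>-integrable functions\<close>

text \<open>
  The crude constant \<open>2\<^sup>p\<close> suffices to see that the \<open>p\<close>-integrable functions are closed under
  differences.
\<close>

lemma norm_diff_powr_le:
  fixes a b :: "'b::real_normed_vector"
  assumes "p \<ge> 0"
  shows "norm (a - b) powr p \<le> 2 powr p * (norm a powr p + norm b powr p)"
proof -
  have "norm (a - b) \<le> 2 * max (norm a) (norm b)"
    using norm_triangle_ineq4[of a b] by linarith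
  then have "norm (a - b) powr p \<le> (2 * max (norm a) (norm b)) powr p"
    using assms by (intro powr_mono2) auto
  also have "\<dots> = 2 powr p * max (norm a) (norm b) powr p"
    by (simp add: powr_mult)
  also have "\<dots> \<le> 2 powr p * (norm a powr p + norm b powr p)"
    by (intro mult_left_mono) (auto simp: max_def)
  finally show ?thesis .
qed

lemma nn_integral_norm_diff_powr_finite:
  assumes "p \<ge> 0" and [measurable]: "strongly_measurable M f" "strongly_measurable M g"
    and fin: "(\<integral>\<^sup>+w. ennreal (norm (f w) powr p) \<partial>M) < \<infinity>" "(\<integral>\<^sup>+w. ennreal (norm (g w) powr p) \<partial>M) < \<infinity>"
  shows "(\<integral>\<^sup>+w. ennreal (norm (f w - g w) powr p) \<partial>M) < \<infinity>"
proof -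
  have "(\<integral>\<^sup>+w. ennreal (norm (f w - g w) powr p) \<partial>M)
      \<le> (\<integral>\<^sup>+w. ennreal (2 powr p) * (ennreal (norm (f w) powr p) + ennreal (norm (g w) powr p)) \<partial>M)"
    using norm_diff_powr_le[OF assms(1)]
    by (intro nn_integral_mono) (simp flip: ennreal_plus ennreal_mult add: ennreal_leI)
  also have "\<dots> = ennreal (2 powr p) * ((\<integral>\<^sup>+w. ennreal (norm (f w) powr p) \<partial>M)
      + (\<integral>\<^sup>+w. ennreal (norm (g w) powr p) \<partial>M))"
    by (simp add: nn_integral_cmult nn_integral_add)
  also have "\<dots> < \<infinity>"
    using fin by (simp add: ennreal_mult_less_top)
  finally show ?thesis .
qed

lemma Lp_space_if_diff_powr_finite:
  assumes "p \<ge> 0" "f \<in> Lp_space M p" "strongly_measurable M g"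
    and "(\<integral>\<^sup>+w. ennreal (norm (f w - g w) powr p) \<partial>M) < \<infinity>"
  shows "g \<in> Lp_space M p"
proof -
  have [measurable]: "strongly_measurable M f" "strongly_measurable M g"
    using assms unfolding Lp_space_def by auto
  have "(\<integral>\<^sup>+w. ennreal (norm (g w) powr p) \<partial>M)
      \<le> (\<integral>\<^sup>+w. ennreal (2 powr p) * (ennreal (norm (f w) powr p) + ennreal (norm (f w - g w) powr p)) \<partial>M)"
    using norm_diff_powr_le[OF assms(1), of "f w" "f w - g w" for w]
    by (intro nn_integral_mono) (simp flip: ennreal_plus ennreal_mult add: ennreal_leI)
  also have "\<dots> = ennreal (2 powr p) * ((\<integral>\<^sup>+w. ennreal (norm (f w) powr p) \<partial>M)
      + (\<integral>\<^sup>+w. ennreal (norm (f w - g w) powr p) \<partial>M))"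
    by (simp add: nn_integral_cmult nn_integral_add)
  also have "\<dots> < \<infinity>"
    using assms by (simp add: ennreal_mult_less_top Lp_space_def)
  finally show ?thesis
    using assms(3) by (simp add: Lp_space_def)
qed

section \<open>Partitions and essential values\<close>

lemma step_fun_eq:
  assumes "i < l" "w \<in> A i" "\<And>j. j < l \<Longrightarrow> j \<noteq> i \<Longrightarrow> w \<notin> A j"
  shows "step_fun l x A w = x i"
proof -
  have "step_fun l x A w = (\<Sum>j<l. if j = i then x i else 0)"
    unfolding step_fun_def by (intro sum.cong) (use assms in \<open>auto simp: indicator_def\<close>)
  then show ?thesis using assms(1) by simp
qed

lemma measurable_partition_imp_ae_partition:
  assumes "measurable_partition M l A"
  shows "ae_partition M l A"
  using assms unfolding measurable_partition_def ae_partition_def disjoint_family_on_def by auto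

lemma ae_partition_values:
  assumes "ae_partition M l A"
  shows "AE w in M. step_fun l x A w \<in> x ` {..<l}"
proof -
  have "AE w in M. w \<notin> A i \<inter> A j" if "i < l" "j < l" "i \<noteq> j" for i j
    using assms that unfolding ae_partition_def by (intro AE_not_in) (auto simp: null_sets_def)
  then have "AE w in M. \<forall>i\<in>{..<l}. \<forall>j\<in>{..<l}. i \<noteq> j \<longrightarrow> w \<notin> A i \<inter> A j"
    by (intro AE_finite_allI) (auto intro!: AE_impI)
  moreover have "AE w in M. w \<notin> space M - (\<Union>i<l. A i)"
    using assms unfolding ae_partition_def
    by (intro AE_not_in) (auto simp: null_sets_def intro!: sets.Diff sets.finite_UN)
  ultimately show ?thesis
    using AE_space
  proof eventually_elim
    case (elim w)
    then obtain i where "i < l" "w \<in> A i" by auto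
    then have "step_fun l x A w = x i"
      using elim by (intro step_fun_eq) auto
    then show ?case using \<open>i < l\<close> by auto
  qed
qed

text \<open>
  Together with \<open>ae_partition_values\<close> this lets sets of essential values stand in for partitions,
  exact or up to null sets. Values are easier to add, drop and count than blocks.
\<close>

lemma finitely_valued_partition:
  assumes h: "strongly_measurable M h"
    and S: "finite S" "S \<noteq> {}" and ae: "AE w in M. h w \<in> S"
  obtains x A where "measurable_partition M (card S) A" "AE w in M. h w = step_fun (card S) x A w"
proof -
  obtain x where x: "bij_betw x {0..<card S} S"
    using ex_bij_betw_nat_finite[OF S(1)] by blast
  have Sx: "S = x ` {..<card S}" and inj: "inj_on x {..<card S}"
    using x by (auto simp: bij_betw_def atLeast0LessThan)
  have l: "0 < card S" using S by (simp add: card_gt_0_iff)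
  \<comment> \<open>An exact partition has to cover the null set of exceptional values too; it goes to block 0.\<close>
  define A where "A i = (if i = 0 then {w \<in> space M. h w \<notin> S} else {}) \<union> {w \<in> space M. h w = x i}" for i
  have "{w \<in> space M. h w \<notin> S} = space M - (\<Union>s\<in>S. {w \<in> space M. h w = s})"
    by auto
  then have "{w \<in> space M. h w \<notin> S} \<in> sets M"
    using strongly_measurable_level_set[OF h] S(1) by (auto intro!: sets.Diff sets.finite_UN)
  then have "A i \<in> sets M" for i
    unfolding A_def using strongly_measurable_level_set[OF h] by auto
  moreover have "disjoint_family_on A {..<card S}"
    using Sx inj_onD[OF inj] l unfolding disjoint_family_on_def A_def
    by (fastforce split: if_splits)
  moreover have "(\<Union>i<card S. A i) = space M"
  proof
    show "(\<Union>i<card S. A i) \<subseteq> space M"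
      unfolding A_def by (auto split: if_splits)
    show "space M \<subseteq> (\<Union>i<card S. A i)"
    proof
      fix w assume w: "w \<in> space M"
      show "w \<in> (\<Union>i<card S. A i)"
      proof (cases "h w \<in> S")
        case True
        then obtain i where "i < card S" "h w = x i" using Sx by auto
        then have "w \<in> A i" using w unfolding A_def by auto
        then show ?thesis using \<open>i < card S\<close> by blast
      next
        case False
        then have "w \<in> A 0" using w unfolding A_def by auto
        then show ?thesis using l by blast
      qed
    qed
  qed
  ultimately have part: "measurable_partition M (card S) A"
    unfolding measurable_partition_def by auto
  have "AE w in M. h w = step_fun (card S) x A w"
    using ae AE_space
  proof eventually_elim
    case (elim w)
    then obtain i where i: "i < card S" "h w = x i" using Sx by auto
    have wA: "w \<in> A i" using i elim unfolding A_def by auto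
    have "step_fun (card S) x A w = x i"
      using part i wA unfolding measurable_partition_def disjoint_family_on_def
      by (intro step_fun_eq) auto
    then show ?case using i by simp
  qed
  with part show ?thesis by (rule that)
qed

lemma G_space_iff_card_values:
  assumes "1 \<le> k" "g \<in> Lp_space M p"
  shows "g \<in> G_space M p k \<longleftrightarrow> (\<exists>S. finite S \<and> card S \<le> k \<and> (AE w in M. g w \<in> S))"
proof
  assume "g \<in> G_space M p k"
  then obtain l x A where l: "l \<le> k" "measurable_partition M l A" "AE w in M. g w = step_fun l x A w"
    unfolding G_space_def by blast
  have "AE w in M. g w \<in> x ` {..<l}"
    using ae_partition_values[OF measurable_partition_imp_ae_partition[OF l(2)], of x] l(3)
    by eventually_elim simp
  moreover have "card (x ` {..<l}) \<le> k"
    using card_image_le[of "{..<l}" x] l(1) by simp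
  ultimately show "\<exists>S. finite S \<and> card S \<le> k \<and> (AE w in M. g w \<in> S)"
    by blast
next
  assume "\<exists>S. finite S \<and> card S \<le> k \<and> (AE w in M. g w \<in> S)"
  then obtain S where S: "finite S" "card S \<le> k" "AE w in M. g w \<in> S" by blast
  \<comment> \<open>\<open>S\<close> can be empty when the whole space is a null set, but a partition has at least one block.\<close>
  define T where "T = (if S = {} then {0} else S)"
  have T: "finite T" "T \<noteq> {}" "card T \<le> k" "AE w in M. g w \<in> T"
    using S assms(1) by (auto simp: T_def)
  obtain x A where "measurable_partition M (card T) A" "AE w in M. g w = step_fun (card T) x A w"
    using finitely_valued_partition[OF _ T(1,2,4)] assms(2) unfolding Lp_space_def by blast
  moreover have "1 \<le> card T" using T by (simp add: Suc_le_eq card_gt_0_iff)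
  ultimately show "g \<in> G_space M p k"
    using assms(2) T(3) unfolding G_space_def by blast
qed

lemma reduced_form_level_sets:
  assumes h: "strongly_measurable M h" and S: "finite S" and ae: "AE w in M. h w \<in> S"
  obtains m x where "reduced_form M h m x (\<lambda>i. {w \<in> space M. h w = x i})" "x ` {..<m} \<subseteq> S"
    "AE w in M. h w \<in> x ` {..<m}"
proof -
  \<comment> \<open>Only the values taken with positive measure survive.\<close>
  define T where "T = {s \<in> S. emeasure M {w \<in> space M. h w = s} > 0}"
  have "finite T" using S by (simp add: T_def)
  then obtain x where x: "bij_betw x {0..<card T} T"
    using ex_bij_betw_nat_finite by blast
  have Tx: "T = x ` {..<card T}" and inj: "inj_on x {..<card T}"
    using x by (auto simp: bij_betw_def atLeast0LessThan)
  define A where "A = (\<lambda>i. {w \<in> space M. h w = x i})"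
  have A: "A i \<in> sets M" for i
    unfolding A_def by (rule strongly_measurable_level_set[OF h])
  have "AE w in M. h w \<noteq> s" if "s \<in> S - T" for s
  proof -
    have "{w \<in> space M. h w = s} \<in> null_sets M"
      using that strongly_measurable_level_set[OF h, of s] by (auto simp: T_def null_sets_def)
    then show ?thesis using AE_not_in AE_space by fastforce
  qed
  then have "AE w in M. \<forall>s\<in>S - T. h w \<noteq> s"
    using S by (intro AE_finite_allI) auto
  with ae have aeT: "AE w in M. h w \<in> T"
    by eventually_elim auto
  have "AE w in M. w \<in> (\<Union>i<card T. A i)"
    using aeT AE_space
  proof eventually_elim
    case (elim w)
    then obtain i where "i < card T" "h w = x i" using Tx by auto
    then show ?case using elim(2) unfolding A_def by auto
  qed
  then have "emeasure M (space M - (\<Union>i<card T. A i)) = 0"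
    by (intro AE_E2[THEN trans[rotated]]) (auto intro!: arg_cong[where f = "emeasure M"] A sets.finite_UN)
  moreover have "A i \<inter> A j = {}" if "i < card T" "j < card T" "i \<noteq> j" for i j
    using inj that unfolding A_def by (auto dest: inj_onD)
  ultimately have "ae_partition M (card T) A"
    using A unfolding ae_partition_def by auto
  moreover have "AE w in M. h w = step_fun (card T) x A w"
    using aeT AE_space
  proof eventually_elim
    case (elim w)
    then obtain i where i: "i < card T" "h w = x i" using Tx by auto
    have "step_fun (card T) x A w = x i"
      using i elim inj by (intro step_fun_eq) (auto simp: A_def dest: inj_onD)
    then show ?case using i by simp
  qed
  moreover have "emeasure M (A i) > 0" if "i < card T" for i
    using that Tx unfolding A_def T_def by auto
  ultimately have "reduced_form M h (card T) x A"
    using inj unfolding reduced_form_def by auto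
  then show ?thesis
    using that[of "card T" x] aeT Tx by (auto simp: A_def T_def)
qed

section \<open>Overwriting a minimizer\<close>

text \<open>
  All functions in \<open>\<G>\<^sub>p\<^sub>,\<^sub>k\<close> are at finite distance from \<open>f\<close>, so minimality of the \<open>L\<^sup>p\<close> norm can be read
  as minimality of the extended-real integral, which can be split over sets without integrability
  conditions.
\<close>

lemma minimizer_le:
  assumes p: "p > 0" and f: "f \<in> Lp_space M p" and min: "is_minimizer M p k f h"
    and g: "g \<in> G_space M p k"
  shows "(\<integral>\<^sup>+w. ennreal (norm (f w - h w) powr p) \<partial>M) \<le> (\<integral>\<^sup>+w. ennreal (norm (f w - g w) powr p) \<partial>M)"
proof -
  define I where "I u = (\<integral>\<^sup>+w. ennreal (norm (f w - u w) powr p) \<partial>M)" for u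
  have fin: "I u < \<infinity>" and norm: "Lp_norm M p (\<lambda>w. f w - u w) = enn2real (I u) powr (1 / p)"
    if "u \<in> G_space M p k" for u
  proof -
    have [measurable]: "strongly_measurable M f" "strongly_measurable M u"
      using f that unfolding G_space_def Lp_space_def by auto
    show "I u < \<infinity>"
      unfolding I_def using f that p unfolding G_space_def Lp_space_def
      by (intro nn_integral_norm_diff_powr_finite) auto
    show "Lp_norm M p (\<lambda>w. f w - u w) = enn2real (I u) powr (1 / p)"
      unfolding Lp_norm_def I_def by (subst integral_eq_nn_integral) auto
  qed
  have h: "h \<in> G_space M p k"
    using min unfolding is_minimizer_def by simp
  have "Lp_norm M p (\<lambda>w. f w - h w) = (INF g\<in>G_space M p k. Lp_norm M p (\<lambda>w. f w - g w))"
    using min unfolding is_minimizer_def by simp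
  also have "\<dots> \<le> Lp_norm M p (\<lambda>w. f w - g w)"
    using g by (intro cINF_lower bdd_belowI2[where m = 0]) (auto simp: Lp_norm_def)
  finally have "enn2real (I h) powr (1 / p) \<le> enn2real (I g) powr (1 / p)"
    by (simp add: norm h g)
  then have "enn2real (I h) \<le> enn2real (I g)"
    using p powr_less_mono2[of "1 / p" "enn2real (I g)" "enn2real (I h)"] by force
  then have "I h \<le> I g"
    using fin[OF h] fin[OF g] by (metis ennreal_enn2real ennreal_leI infinity_ennreal_def)
  then show ?thesis by (simp add: I_def)
qed

text \<open>
  The left hand side is the cost of \<open>h\<close> on \<open>B\<close>. Compare \<open>h\<close> with the function that equals \<open>y\<close> on \<open>B\<close>
  and \<open>h\<close> elsewhere: the two agree off \<open>B\<close>, where their common cost is finite and can be cancelled. If the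
  right hand side is finite, then so is the total cost of the modified function; this is what puts it
  into \<open>L\<^sup>p\<close>, even when \<open>B\<close> has infinite measure.
\<close>

lemma minimizer_overwrite:
  assumes p: "p > 0" and k: "1 \<le> k" and f: "f \<in> Lp_space M p" and min: "is_minimizer M p k f h"
    and B: "B \<in> sets M"
    and S: "finite S" "card S \<le> k" "AE w in M. (if w \<in> B then y else h w) \<in> S"
  shows "pth_moment M p (\<lambda>w. f w - h w) B 0 \<le> pth_moment M p f B y"
proof (cases "pth_moment M p f B y < \<infinity>")
  case True
  define g where "g w = (if w \<in> B then y else h w)" for w
  define J where "J u C = (\<integral>\<^sup>+w\<in>C. ennreal (norm (f w - u w) powr p) \<partial>M)" for u C
  have hG: "h \<in> G_space M p k" and hL: "h \<in> Lp_space M p"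
    using min unfolding is_minimizer_def G_space_def by auto
  have sm [measurable]: "strongly_measurable M f" "strongly_measurable M h"
    using f hL unfolding Lp_space_def by auto
  have g_sm [measurable]: "strongly_measurable M g"
    unfolding g_def using sm(2) B by (rule strongly_measurable_If_set)
  note [measurable] = B
  have split: "(\<integral>\<^sup>+w. ennreal (norm (f w - u w) powr p) \<partial>M) = J u B + J u (space M - B)"
    if [measurable]: "strongly_measurable M u" for u
  proof -
    have "(\<integral>\<^sup>+w. ennreal (norm (f w - u w) powr p) \<partial>M)
      = (\<integral>\<^sup>+w. ennreal (norm (f w - u w) powr p) * indicator B w
            + ennreal (norm (f w - u w) powr p) * indicator (space M - B) w \<partial>M)"
      by (intro nn_integral_cong) (auto simp: indicator_def)
    then show ?thesis
      unfolding J_def by (simp add: nn_integral_add)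
  qed
  have off: "J g (space M - B) = J h (space M - B)"
    unfolding J_def g_def by (intro nn_integral_cong) (auto simp: indicator_def)
  have on: "J g B = pth_moment M p f B y"
    unfolding J_def g_def pth_moment_def by (intro nn_integral_cong) (auto simp: indicator_def)
  have "(\<integral>\<^sup>+w. ennreal (norm (f w - h w) powr p) \<partial>M) < \<infinity>"
    using f hL p unfolding Lp_space_def by (intro nn_integral_norm_diff_powr_finite) auto
  then have fin: "J h (space M - B) < \<infinity>"
    by (simp add: split[OF sm(2)])
  have "g \<in> Lp_space M p"
    using p f g_sm
    by (rule Lp_space_if_diff_powr_finite[OF less_imp_le]) (use fin True in \<open>simp add: split[OF g_sm] off on\<close>)
  then have "g \<in> G_space M p k"
    using G_space_iff_card_values[OF k] S unfolding g_def by blast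
  from minimizer_le[OF p f min this]
  have "J h B + J h (space M - B) \<le> J g B + J h (space M - B)"
    by (simp add: split[OF sm(2)] split[OF g_sm] off)
  then have "J h B \<le> J g B"
    using fin by (metis add.commute ennreal_add_left_cancel_le infinity_ennreal_def less_irrefl)
  then show ?thesis
    by (simp add: on) (simp add: J_def pth_moment_def)
qed (simp add: not_less top.extremum_unique)

text \<open>
  Overwriting \<open>h\<close> by \<open>y\<close> exactly where \<open>y\<close> is strictly closer to \<open>f\<close> strictly lowers a finite cost
  unless this happens on a null set only. The bound \<open>card (insert y S) \<le> k\<close> covers both
  applications: \<open>y\<close> is already a value of \<open>h\<close>, or a further value is still available.
\<close>

lemma minimizer_nearest:
  assumes p: "p > 0" and k: "1 \<le> k" and f: "f \<in> Lp_space M p" and min: "is_minimizer M p k f h"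
    and S: "finite S" "card (insert y S) \<le> k" "AE w in M. h w \<in> S"
  shows "AE w in M. norm (f w - h w) \<le> norm (f w - y)"
proof (rule ccontr)
  assume neg: "\<not> ?thesis"
  define B where "B = {w \<in> space M. norm (f w - y) < norm (f w - h w)}"
  have hL: "h \<in> Lp_space M p"
    using min unfolding is_minimizer_def G_space_def by auto
  have sm[measurable]: "strongly_measurable M f" "strongly_measurable M h"
    using f hL unfolding Lp_space_def by auto
  have [measurable]: "(\<lambda>w. norm (f w - y)) \<in> borel_measurable M"
    by (intro strongly_measurable_norm_diff sm strongly_measurable_const)
  have B[measurable]: "B \<in> sets M"
    unfolding B_def by measurable
  have hfin: "(\<integral>\<^sup>+w. ennreal (norm (f w - h w) powr p) \<partial>M) < \<infinity>"
    using f hL p unfolding Lp_space_def by (intro nn_integral_norm_diff_powr_finite) auto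
  have le: "pth_moment M p f B y \<le> (\<integral>\<^sup>+w. ennreal (norm (f w - h w) powr p) \<partial>M)"
    unfolding pth_moment_def using p
    by (intro nn_integral_mono) (auto simp: B_def indicator_def intro!: ennreal_leI powr_mono2)
  have "pth_moment M p f B y < pth_moment M p (\<lambda>w. f w - h w) B 0"
    unfolding pth_moment_def
  proof (rule nn_integral_less)
    show "(\<integral>\<^sup>+w\<in>B. ennreal (norm (f w - y) powr p) \<partial>M) \<noteq> \<infinity>"
      using le hfin unfolding pth_moment_def by auto
    show "AE w in M. ennreal (norm (f w - y) powr p) * indicator B w
        \<le> ennreal (norm (f w - h w - 0) powr p) * indicator B w"
      using p by (intro AE_I2) (auto simp: B_def indicator_def intro!: ennreal_leI powr_mono2)
    show "\<not> (AE w in M. ennreal (norm (f w - h w - 0) powr p) * indicator B w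
        \<le> ennreal (norm (f w - y) powr p) * indicator B w)"
    proof
      assume "AE w in M. ennreal (norm (f w - h w - 0) powr p) * indicator B w
        \<le> ennreal (norm (f w - y) powr p) * indicator B w"
      then have "AE w in M. norm (f w - h w) \<le> norm (f w - y)"
        using AE_space
      proof eventually_elim
        case (elim w)
        show ?case
        proof (rule ccontr)
          assume "\<not> ?case"
          then have "w \<in> B" and "norm (f w - y) powr p < norm (f w - h w) powr p"
            using elim(2) p by (auto simp: B_def intro!: powr_less_mono2)
          with elim(1) show False by simp
        qed
      qed
      with neg show False ..
    qed
  qed simp_all
  moreover have "AE w in M. (if w \<in> B then y else h w) \<in> insert y S"
    using S(3) by eventually_elim auto
  then have "pth_moment M p (\<lambda>w. f w - h w) B 0 \<le> pth_moment M p f B y"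
    using S(1,2) by (intro minimizer_overwrite[OF p k f min B, of "insert y S"]) auto
  ultimately show False by simp
qed

section \<open>Structure of minimizers\<close>

lemma minimizer_special_voronoi_form:
  assumes p: "p > 0" and k: "1 \<le> k" and f: "f \<in> Lp_space M p" and min: "is_minimizer M p k f h"
  shows "\<exists>m x A. special_voronoi_form M p f h m x A"
proof -
  have hG: "h \<in> G_space M p k" and hL: "h \<in> Lp_space M p"
    using min unfolding is_minimizer_def G_space_def by auto
  have h: "strongly_measurable M h" using hL unfolding Lp_space_def by auto
  obtain S where S: "finite S" "card S \<le> k" "AE w in M. h w \<in> S"
    using G_space_iff_card_values[OF k hL] hG by blast
  obtain m x where red: "reduced_form M h m x (\<lambda>i. {w \<in> space M. h w = x i})"
    and xS: "x ` {..<m} \<subseteq> S" and xv: "AE w in M. h w \<in> x ` {..<m}"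
    using reduced_form_level_sets[OF h S(1,3)] by blast
  define A where "A = (\<lambda>i. {w \<in> space M. h w = x i})"
  have nearest: "AE w in M. norm (f w - h w) \<le> norm (f w - x j)" if "j < m" for j
  proof -
    have "insert (x j) S = S" using xS that by auto
    then show ?thesis
      using minimizer_nearest[OF p k f min S(1) _ S(3)] S(2) by simp
  qed
  have "AE w in M. \<forall>j\<in>{..<m}. norm (f w - h w) \<le> norm (f w - x j)"
    by (rule AE_finite_allI) (use nearest in auto)
  then have "AE w in M. w \<in> A i \<longrightarrow> w \<in> f -` voronoi_cell m x i" for i
    by eventually_elim (auto simp: voronoi_cell_def A_def)
  then have vor: "voronoi_form M f h m x A"
    using red unfolding voronoi_form_def A_def by auto
  have "is_pth_mean M p f (A i) (x i)" if i: "i < m" for i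
    unfolding is_pth_mean_def
  proof (rule antisym)
    show "pth_moment M p f (A i) (x i) \<le> (INF y. pth_moment M p f (A i) y)"
    proof (rule INF_greatest)
      fix y
      \<comment> \<open>Giving up the value \<open>x i\<close> makes room for \<open>y\<close>, even when all \<open>k\<close> values are in use.\<close>
      define T where "T = insert y (x ` {..<m} - {x i})"
      have "AE w in M. (if w \<in> A i then y else h w) \<in> T"
        using xv AE_space by eventually_elim (auto simp: T_def A_def)
      moreover have "card T \<le> k"
      proof -
        have "card T \<le> Suc (card (x ` {..<m} - {x i}))"
          unfolding T_def by (rule card_insert_le_m1) auto
        also have "\<dots> = card (x ` {..<m})"
          using i by (intro card.remove[symmetric]) auto
        also have "\<dots> \<le> k"
          using card_mono[OF S(1) xS] S(2) by simp
        finally show ?thesis .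
      qed
      moreover have "A i \<in> sets M"
        unfolding A_def by (rule strongly_measurable_level_set[OF h])
      ultimately have "pth_moment M p (\<lambda>w. f w - h w) (A i) 0 \<le> pth_moment M p f (A i) y"
        by (intro minimizer_overwrite[OF p k f min, where S = T]) (auto simp: T_def)
      also have "pth_moment M p (\<lambda>w. f w - h w) (A i) 0 = pth_moment M p f (A i) (x i)"
        unfolding pth_moment_def by (intro nn_integral_cong) (auto simp: A_def indicator_def)
      finally show "pth_moment M p f (A i) (x i) \<le> pth_moment M p f (A i) y" .
    qed
  qed (rule INF_lower, simp)
  with vor show ?thesis
    unfolding special_voronoi_form_def by blast
qed

text \<open>
  Any single point could be added as a value, so almost every \<open>f w\<close> is at least as close to \<open>h w\<close> as
  to that point. The exceptional null set depends on the point, hence the restriction to a countable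
  set of points that come arbitrarily close to every \<open>f w\<close>.
\<close>

lemma minimizer_few_values_eq:
  assumes p: "p > 0" and f: "f \<in> Lp_space M p" and min: "is_minimizer M p k f h"
    and S: "finite S" "card S < k" "AE w in M. h w \<in> S"
  shows "AE w in M. f w = h w"
proof -
  obtain D where D: "countable D" "\<And>w e. w \<in> space M \<Longrightarrow> e > 0 \<Longrightarrow> \<exists>d\<in>D. norm (f w - d) < e"
    using strongly_measurable_separable_range f unfolding Lp_space_def by blast
  have "AE w in M. norm (f w - h w) \<le> norm (f w - d)" for d
    using S by (intro minimizer_nearest[OF p _ f min, of S]) (auto simp: card_insert_if)
  then have "AE w in M. \<forall>d\<in>D. norm (f w - h w) \<le> norm (f w - d)"
    by (simp add: AE_ball_countable D(1))
  then show ?thesis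
    using AE_space
  proof eventually_elim
    case (elim w)
    show ?case
    proof (rule ccontr)
      assume "f w \<noteq> h w"
      then obtain d where "d \<in> D" "norm (f w - d) < norm (f w - h w)"
        using D(2)[OF elim(2), of "norm (f w - h w)"] by auto
      with elim(1) show False by force
    qed
  qed
qed

lemma minimizer_simple_degree:
  assumes p: "p > 0" and k: "1 \<le> k" and f: "f \<in> Lp_space M p" and min: "is_minimizer M p k f h"
    and nG: "f \<notin> G_space M p k"
  shows "simple_degree M h = k"
proof -
  define P where "P l \<longleftrightarrow> 1 \<le> l \<and> (\<exists>y B. ae_partition M l B \<and> (AE w in M. h w = step_fun l y B w))" for l
  have ge: "k \<le> l" if "P l" for l
  proof (rule ccontr)
    assume "\<not> k \<le> l"
    obtain y B where B: "ae_partition M l B" "AE w in M. h w = step_fun l y B w"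
      using \<open>P l\<close> unfolding P_def by blast
    have v: "AE w in M. h w \<in> y ` {..<l}"
      using B(2) ae_partition_values[OF B(1), of y] by eventually_elim simp
    have c: "card (y ` {..<l}) < k"
      using card_image_le[of "{..<l}" y] \<open>\<not> k \<le> l\<close> by simp
    have "AE w in M. f w = h w"
      using minimizer_few_values_eq[OF p f min _ c v] by simp
    with v have "AE w in M. f w \<in> y ` {..<l}"
      by eventually_elim simp
    then have "f \<in> G_space M p k"
      unfolding G_space_iff_card_values[OF k f] using c by (intro exI[of _ "y ` {..<l}"]) auto
    with nG show False ..
  qed
  obtain l where l: "l \<le> k" "P l"
    using min measurable_partition_imp_ae_partition
    unfolding is_minimizer_def G_space_def P_def by blast
  with ge have "P k" by (metis antisym)
  then have "(LEAST l. P l) = k"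
    by (rule Least_equality) (rule ge)
  then show ?thesis
    unfolding simple_degree_def P_def .
qed

theorem theorem4p2:
  fixes M :: "'a measure" and f h :: "'a \<Rightarrow> 'b::banach" and p :: real and k :: nat
  assumes "1 \<le> p" and "1 \<le> k"
    and "f \<in> Lp_space M p"
    and "is_minimizer M p k f h"
  shows "(\<exists>m x A. special_voronoi_form M p f h m x A) \<and>
         (f \<notin> G_space M p k \<longrightarrow> simple_degree M h = k)"
  using minimizer_special_voronoi_form[of p k f M h] minimizer_simple_degree[of p k f M h] assms
  by auto

end
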